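(* The left division $\lhd$ and the right division $\rhd$ on the monomials of $R\langle x_1,\dots,x_n\rangle$ are strong involutive divisions.
   Context: Monomials are words in the noncommuting variables $x_1,\dots,x_n$. An involutive division is a rule $I$ assigning to every finite set $U$ of monomials and every $u\in U$ a set $\mathcal M^L_I(u,U)\subseteq\{x_1,\dots,x_n\}$ of left multiplicative variables and a set $\mathcal M^R_I(u,U)\subseteq\{x_1,\dots,x_n\}$ of right multiplicative variables. For $u\in U$ and a factorisation $w=v_1uv_2$, $u$ is an involutive divisor of $w$ at this factorisation if (thin divisors) the last letter of $v_1$ (if $v_1\ne1$) is in $\mathcal M^L_I(u,U)$ and the first letter of $v_2$ (if $v_2\neq1$) is in $\mathcal M^R_I(u,U)$. Write $u\mid_I w$ if this holds for some factorisation, and let $\mathcal C_I(u,U)=\{w : u\mid_I w\}$. $I$ is strong if for every finite $U$: (Disjoint Cones) if $\mathcal C_I(u_1,U)\cap\mathcal C_I(u_2,U)\ne\emptyset$ for $u_1,u_2\in U$, then one of these cones is contained in the other; (Unique Divisor) each $w\in\mathcal C_I(u,U)$ is involutively divisible by $u$ at exactly one factorisation; (Subset) if $V\subset U$ then $\mathcal M^L_I(v,U)\subseteq\mathcal M^L_I(v,V)$ and $\mathcal M^R_I(v,U)\subseteq\mathcal M^R_I(v,V)$ for all $v\in V$. Left division $\lhd$: for every $U$ and $u\in U$, all variables are left multiplicative and no variable is right multiplicative. Right division $\rhd$: for every $U$ and $u\in U$, no variable is left multiplicative and all variables are right multiplicative. *)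

theory Defs
  imports Main
begin

text \<open>The variable \<open>x\<^sub>i\<close> is represented by its index \<open>i\<close>, a monomial by the list of its
  letters; \<open>1\<close> is the empty list and multiplication is concatenation.\<close>

definition variables :: "nat \<Rightarrow> nat set" where
  "variables n = {1..n}"

definition monomials :: "nat \<Rightarrow> nat list set" where
  "monomials n = lists (variables n)"

text \<open>The values of the two fields at \<open>u\<close> and \<open>U\<close> are only relevant for finite sets \<open>U\<close> of
  monomials and \<open>u \<in> U\<close>; every condition below is restricted to such arguments.\<close>

record division_rule =
  left_mult :: "nat list \<Rightarrow> nat list set \<Rightarrow> nat set"
  right_mult :: "nat list \<Rightarrow> nat list set \<Rightarrow> nat set"

definition involutive_division :: "nat \<Rightarrow> division_rule \<Rightarrow> bool" where
  "involutive_division n I \<longleftrightarrow>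
    (\<forall>U. finite U \<and> U \<subseteq> monomials n \<longrightarrow>
      (\<forall>u\<in>U. left_mult I u U \<subseteq> variables n \<and> right_mult I u U \<subseteq> variables n))"

definition inv_divisor_at ::
  "nat \<Rightarrow> division_rule \<Rightarrow> nat list set \<Rightarrow> nat list \<Rightarrow> nat list \<Rightarrow> nat list \<Rightarrow> nat list \<Rightarrow> bool" where
  "inv_divisor_at n I U u w v1 v2 \<longleftrightarrow>
    v1 \<in> monomials n \<and> v2 \<in> monomials n \<and> w = v1 @ u @ v2 \<and>
    (v1 \<noteq> [] \<longrightarrow> last v1 \<in> left_mult I u U) \<and>
    (v2 \<noteq> [] \<longrightarrow> hd v2 \<in> right_mult I u U)"

definition inv_divides ::
  "nat \<Rightarrow> division_rule \<Rightarrow> nat list set \<Rightarrow> nat list \<Rightarrow> nat list \<Rightarrow> bool" where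
  "inv_divides n I U u w \<longleftrightarrow> (\<exists>v1 v2. inv_divisor_at n I U u w v1 v2)"

definition inv_cone ::
  "nat \<Rightarrow> division_rule \<Rightarrow> nat list \<Rightarrow> nat list set \<Rightarrow> nat list set" where
  "inv_cone n I u U = {w \<in> monomials n. inv_divides n I U u w}"

definition disjoint_cones :: "nat \<Rightarrow> division_rule \<Rightarrow> nat list set \<Rightarrow> bool" where
  "disjoint_cones n I U \<longleftrightarrow>
    (\<forall>u1\<in>U. \<forall>u2\<in>U. inv_cone n I u1 U \<inter> inv_cone n I u2 U \<noteq> {} \<longrightarrow>
      inv_cone n I u1 U \<subseteq> inv_cone n I u2 U \<or> inv_cone n I u2 U \<subseteq> inv_cone n I u1 U)"

definition unique_divisor :: "nat \<Rightarrow> division_rule \<Rightarrow> nat list set \<Rightarrow> bool" where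
  "unique_divisor n I U \<longleftrightarrow>
    (\<forall>u\<in>U. \<forall>w\<in>inv_cone n I u U. \<exists>!(v1, v2). inv_divisor_at n I U u w v1 v2)"

definition subset_condition :: "division_rule \<Rightarrow> nat list set \<Rightarrow> bool" where
  "subset_condition I U \<longleftrightarrow>
    (\<forall>V\<subseteq>U. \<forall>v\<in>V. left_mult I v U \<subseteq> left_mult I v V \<and> right_mult I v U \<subseteq> right_mult I v V)"

definition strong_involutive_division :: "nat \<Rightarrow> division_rule \<Rightarrow> bool" where
  "strong_involutive_division n I \<longleftrightarrow>
    involutive_division n I \<and>
    (\<forall>U. finite U \<and> U \<subseteq> monomials n \<longrightarrow>
      disjoint_cones n I U \<and> unique_divisor n I U \<and> subset_condition I U)"

definition left_division :: "nat \<Rightarrow> division_rule" where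
  "left_division n = \<lparr>left_mult = (\<lambda>u U. variables n), right_mult = (\<lambda>u U. {})\<rparr>"

definition right_division :: "nat \<Rightarrow> division_rule" where
  "right_division n = \<lparr>left_mult = (\<lambda>u U. {}), right_mult = (\<lambda>u U. variables n)\<rparr>"

end

theory Submission
  imports Defs
begin

text \<open>The cone of \<open>u\<close> consists of the words with suffix (for left division) or prefix (for right
  division) \<open>u\<close>. Two suffixes of the same word are comparable, and then so are their cones; the
  same holds for prefixes.\<close>

text \<open>With no right multiplicative variable a nonempty \<open>v2\<close> would have no
  admissible first letter, while the last letter of a monomial \<open>v1\<close> is always a
  variable and hence left multiplicative.\<close>

lemma inv_divisor_at_left_division:
  "inv_divisor_at n (left_division n) U u w v1 v2 \<longleftrightarrow> v1 \<in> monomials n \<and> v2 = [] \<and> w = v1 @ u"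
  by (auto simp: inv_divisor_at_def left_division_def monomials_def in_lists_conv_set)

lemma inv_divisor_at_right_division:
  "inv_divisor_at n (right_division n) U u w v1 v2 \<longleftrightarrow> v1 = [] \<and> v2 \<in> monomials n \<and> w = u @ v2"
  by (auto simp: inv_divisor_at_def right_division_def monomials_def in_lists_conv_set)

lemma inv_cone_left_division:
  assumes "u \<in> monomials n"
  shows "inv_cone n (left_division n) u U = (\<lambda>v. v @ u) ` monomials n"
  using assms
  by (auto simp: inv_cone_def inv_divides_def inv_divisor_at_left_division monomials_def)

lemma inv_cone_right_division:
  assumes "u \<in> monomials n"
  shows "inv_cone n (right_division n) u U = (\<lambda>v. u @ v) ` monomials n"
  using assms
  by (auto simp: inv_cone_def inv_divides_def inv_divisor_at_right_division monomials_def)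

lemma disjoint_cones_left_division:
  assumes "U \<subseteq> monomials n"
  shows "disjoint_cones n (left_division n) U"
  unfolding disjoint_cones_def
proof (intro ballI impI)
  fix u1 u2
  let ?C = "\<lambda>u. inv_cone n (left_division n) u U"
  assume "u1 \<in> U" "u2 \<in> U" and ne: "?C u1 \<inter> ?C u2 \<noteq> {}"
  with assms have u: "u1 \<in> monomials n" "u2 \<in> monomials n" by auto
  from ne obtain v1 v2 where "v1 @ u1 = v2 @ u2"
    by (auto simp: inv_cone_left_division u)
  \<comment> \<open>\<open>x\<close> is what remains of the longer of \<open>v1\<close> and
    \<open>v2\<close> once the shorter, a prefix of it, is removed.\<close>
  then obtain x where "u1 = x @ u2 \<or> u2 = x @ u1"
    by (auto simp: append_eq_append_conv2)
  \<comment> \<open>If \<open>u1 = x @ u2\<close>, then \<open>x\<close> is a monomial and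
    \<open>v @ u1 = (v @ x) @ u2\<close>; the flipped \<open>append_assoc\<close> produces this
    bracketing.\<close>
  with u show "?C u1 \<subseteq> ?C u2 \<or> ?C u2 \<subseteq> ?C u1"
    by (fastforce simp: inv_cone_left_division u monomials_def simp flip: append_assoc)
qed

lemma disjoint_cones_right_division:
  assumes "U \<subseteq> monomials n"
  shows "disjoint_cones n (right_division n) U"
  unfolding disjoint_cones_def
proof (intro ballI impI)
  fix u1 u2
  let ?C = "\<lambda>u. inv_cone n (right_division n) u U"
  assume "u1 \<in> U" "u2 \<in> U" and ne: "?C u1 \<inter> ?C u2 \<noteq> {}"
  with assms have u: "u1 \<in> monomials n" "u2 \<in> monomials n" by auto
  from ne obtain v1 v2 where "u1 @ v1 = u2 @ v2"
    by (auto simp: inv_cone_right_division u)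
  \<comment> \<open>Here \<open>x\<close> is the rest of the longer of \<open>u1\<close> and
    \<open>u2\<close> after the shorter.\<close>
  then obtain x where "u1 = u2 @ x \<or> u2 = u1 @ x"
    by (auto simp: append_eq_append_conv2)
  with u show "?C u1 \<subseteq> ?C u2 \<or> ?C u2 \<subseteq> ?C u1"
    by (fastforce simp: inv_cone_right_division u monomials_def)
qed

text \<open>As \<open>v2\<close> is empty, cancelling the suffix \<open>u\<close> in
  \<open>w = v1 @ u\<close> determines \<open>v1\<close>.\<close>

lemma unique_divisor_left_division: "unique_divisor n (left_division n) U"
  by (auto simp: unique_divisor_def inv_cone_def inv_divides_def inv_divisor_at_left_division)

lemma unique_divisor_right_division: "unique_divisor n (right_division n) U"
  by (auto simp: unique_divisor_def inv_cone_def inv_divides_def inv_divisor_at_right_division)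

theorem proposition5p5p6:
  fixes n :: nat
  shows "strong_involutive_division n (left_division n) \<and>
         strong_involutive_division n (right_division n)"
  by (simp add: strong_involutive_division_def
      disjoint_cones_left_division disjoint_cones_right_division
      unique_divisor_left_division unique_divisor_right_division)
    \<comment> \<open>The multiplicative sets do not depend on \<open>U\<close>, so the inclusions
      of the subset condition are equalities.\<close>
    (simp add: involutive_division_def subset_condition_def left_division_def right_division_def)

end
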